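(* Let $n\ge 3$ be an integer and let $R_n^2=\langle (n-1)^2,n^2,(n+1)^2\rangle$. Then $R_n^2$ is symmetric if and only if $n\in\{3,4,5\}$.
   Context: For positive integers $d_1,d_2,d_3$ with $\gcd(d_1,d_2,d_3)=1$, $\langle d_1,d_2,d_3\rangle=\{x_1d_1+x_2d_2+x_3d_3 : x_i\in\mathbb{Z}_{\ge 0}\}$ is the numerical semigroup generated by $d_1,d_2,d_3$ (the generators need not be a minimal generating set). The Frobenius number $F(S)$ of a numerical semigroup $S$ is the largest integer not in $S$. A numerical semigroup $S$ is symmetric if for every integer $s$ exactly one of $s$ and $F(S)-s$ belongs to $S$. *)

theory Defs
  imports Main
begin

text \<open>
  Numerical semigroups are taken as subsets of the integers rather than of the naturals, since the
  Frobenius number may be negative (it is -1 when the semigroup is all of the nonnegative integers)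
  and symmetry quantifies over all integers.
\<close>

definition semigroup3 :: "int \<Rightarrow> int \<Rightarrow> int \<Rightarrow> int set" where
  "semigroup3 d1 d2 d3 =
     {x1 * d1 + x2 * d2 + x3 * d3 | x1 x2 x3. 0 \<le> x1 \<and> 0 \<le> x2 \<and> 0 \<le> x3}"

text \<open>
  The greatest integer outside \<open>S\<close> exists for numerical semigroups, in particular for
  \<open>semigroup3 d1 d2 d3\<close> with positive generators satisfying \<open>gcd d1 (gcd d2 d3) = 1\<close>;
  for other sets the value may be unspecified.
\<close>

definition frobenius_number :: "int set \<Rightarrow> int" where
  "frobenius_number S = (GREATEST s. s \<notin> S)"

definition symmetric_semigroup :: "int set \<Rightarrow> bool" where
  "symmetric_semigroup S \<longleftrightarrow>
     (\<forall>s. (s \<in> S \<and> frobenius_number S - s \<notin> S) \<or> (s \<notin> S \<and> frobenius_number S - s \<in> S))"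

end

theory Submission
  imports Defs
begin

text \<open>
  The theorem rests on the classical criterion of Herzog and Delorme: up to a permutation, symmetry
  of \<open>\<langle>d1, d2, d3\<rangle>\<close> forces \<open>d3 \<in> \<langle>d1 / g, d2 / g\<rangle>\<close> with \<open>g = gcd d1 d2\<close>, and
  conversely when \<open>d1, d2, d3\<close> have gcd 1.

  For necessity, let \<open>c\<^sub>i\<close> be the least positive integer with \<open>c\<^sub>i d\<^sub>i\<close> in the semigroup of the other
  two generators. If no generator lies in such a quotient semigroup, then every representation of
  \<open>c\<^sub>i d\<^sub>i\<close> uses both other generators, so in the Apery set of \<open>d1\<close> the exponents of \<open>d2\<close>, \<open>d3\<close> are
  below \<open>c\<^sub>2\<close>, \<open>c\<^sub>3\<close>. Symmetry makes \<open>F + d1\<close> the maximum of that Apery set, above both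
  \<open>(c\<^sub>2 - 1) d2\<close> and \<open>(c\<^sub>3 - 1) d3\<close>, whence \<open>F + d1 = (c\<^sub>2 - 1) d2 + (c\<^sub>3 - 1) d3\<close>. Comparing this with
  the analogous formula for \<open>F + d2\<close> gives \<open>c\<^sub>1 d1 = c\<^sub>2 d2\<close>, a contradiction.

  For sufficiency, the integers have unique coordinates \<open>g p x + g q y + d3 z\<close> with \<open>0 \<le> y < p\<close>,
  \<open>0 \<le> z < g\<close>, and membership means \<open>x \<ge> 0\<close>, while \<open>s \<mapsto> F - s\<close> sends
  \<open>(x, y, z)\<close> to \<open>(-1 - x, p - 1 - y, g - 1 - z)\<close>.
\<close>

text \<open>Encodes \<open>d3 \<in> \<langle>d1 / g, d2 / g\<rangle>\<close> for \<open>g = gcd d1 d2\<close>.\<close>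
definition glued :: "int \<Rightarrow> int \<Rightarrow> int \<Rightarrow> bool" where
  "glued d1 d2 d3 \<longleftrightarrow>
     (\<exists>g p q u v. 0 < g \<and> d1 = g * p \<and> d2 = g * q \<and> coprime p q \<and> 0 \<le> u \<and> 0 \<le> v \<and> d3 = u * p + v * q)"

definition least_relation :: "int \<Rightarrow> int \<Rightarrow> int \<Rightarrow> int \<Rightarrow> bool" where
  "least_relation c d e f \<longleftrightarrow>
     0 < c \<and> (\<exists>y z. 0 \<le> y \<and> 0 \<le> z \<and> c * d = y * e + z * f) \<and>
     (\<forall>x y z. 0 < x \<longrightarrow> 0 \<le> y \<longrightarrow> 0 \<le> z \<longrightarrow> x * d = y * e + z * f \<longrightarrow> c \<le> x)"

section \<open>Representations, least relations and congruences\<close>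

lemma semigroup3I:
  "0 \<le> x \<Longrightarrow> 0 \<le> y \<Longrightarrow> 0 \<le> z \<Longrightarrow> s = x * d1 + y * d2 + z * d3 \<Longrightarrow> s \<in> semigroup3 d1 d2 d3"
  unfolding semigroup3_def by blast

lemma semigroup3E:
  assumes "s \<in> semigroup3 d1 d2 d3"
  obtains x y z where "0 \<le> x" "0 \<le> y" "0 \<le> z" "s = x * d1 + y * d2 + z * d3"
  using assms unfolding semigroup3_def by blast

lemma semigroup3_swap12: "semigroup3 d1 d2 d3 = semigroup3 d2 d1 d3"
proof -
  have "s \<in> semigroup3 b a c" if "s \<in> semigroup3 a b c" for a b c s
    using that
  proof (rule semigroup3E)
    fix x y z assume "0 \<le> x" "0 \<le> y" "0 \<le> z" "s = x * a + y * b + z * c"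
    then show ?thesis by (intro semigroup3I[of y x z]) simp_all
  qed
  then show ?thesis by blast
qed

lemma semigroup3_swap23: "semigroup3 d1 d2 d3 = semigroup3 d1 d3 d2"
proof -
  have "s \<in> semigroup3 a c b" if "s \<in> semigroup3 a b c" for a b c s
    using that
  proof (rule semigroup3E)
    fix x y z assume "0 \<le> x" "0 \<le> y" "0 \<le> z" "s = x * a + y * b + z * c"
    then show ?thesis by (intro semigroup3I[of x z y]) simp_all
  qed
  then show ?thesis by blast
qed

lemma glued_commute: "glued d1 d2 d3 \<Longrightarrow> glued d2 d1 d3"
  unfolding glued_def by (metis add.commute coprime_commute)

lemma least_relation_commute: "least_relation c d e f \<longleftrightarrow> least_relation c d f e"
  unfolding least_relation_def by (metis add.commute)

lemma least_relation_exists: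
  assumes "0 < d" "0 < e"
  obtains c where "least_relation c d e f"
proof -
  define P where "P k \<longleftrightarrow> 0 < k \<and> (\<exists>y z. 0 \<le> y \<and> 0 \<le> z \<and> int k * d = y * e + z * f)" for k :: nat
  \<comment> \<open>The trivial relation \<open>e * d = d * e + 0 * f\<close> shows that some
    multiplier is admissible.\<close>
  have "0 \<le> d \<and> 0 \<le> (0::int) \<and> int (nat e) * d = d * e + 0 * f" using assms by simp
  then have "P (nat e)"
    using assms unfolding P_def by (metis zero_less_nat_eq)
  then have L: "P (Least P)" and min: "\<And>k. P k \<Longrightarrow> Least P \<le> k"
    by (auto intro: LeastI Least_le)
  have "int (Least P) \<le> x" if "0 < x" "0 \<le> y" "0 \<le> z" "x * d = y * e + z * f" for x y z
  proof -
    have "P (nat x)" using that unfolding P_def by auto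
    from min[OF this] show ?thesis using that by linarith
  qed
  with L have "least_relation (int (Least P)) d e f"
    unfolding least_relation_def P_def by auto
  then show ?thesis ..
qed

text \<open>The Bezout coefficient of \<open>a\<close> inverts \<open>a\<close> modulo
  \<open>m\<close>; multiplying it by \<open>t\<close> and reducing modulo \<open>m\<close> gives
  \<open>z\<close>.\<close>

lemma coprime_solve_mod:
  fixes a m t :: int
  assumes "coprime a m" "0 < m"
  obtains z where "0 \<le> z" "z < m" "m dvd t - a * z"
proof -
  obtain u v where uv: "u * a + v * m = 1"
    using bezout_int[of a m] assms by (auto simp: coprime_iff_gcd_eq_1)
  define z where "z = (u * t) mod m"
  have "t - a * z = t * (u * a + v * m) - a * (u * t - m * ((u * t) div m))"
    unfolding uv z_def by (simp add: minus_mult_div_eq_mod)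
  also have "\<dots> = m * (t * v + a * ((u * t) div m))"
    by (simp add: algebra_simps)
  finally have "m dvd t - a * z" by simp
  with that[of z] show ?thesis unfolding z_def using assms by simp
qed

section \<open>Necessity: symmetry forces a gluing\<close>

text \<open>
  If \<open>c1 d1 = k d2\<close>, then \<open>c1 = d2 / g\<close>, and solving \<open>c d1 / g \<equiv> d3\<close> modulo \<open>d2 / g\<close> with \<open>0 \<le> c < c1\<close>
  yields either the wanted representation of \<open>d3\<close> or a relation smaller than the least one.
\<close>
lemma glued_if_degenerate_relation:
  assumes pos: "0 < d1" "0 < d2" "0 < d3"
    and c: "least_relation c d1 d2 d3" and eq: "c * d1 = k * d2"
  shows "glued d1 d2 d3"
proof -
  define g where "g = gcd d1 d2"
  have g0: "0 < g" using pos by (simp add: g_def)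
  obtain p q where pq: "d1 = g * p" "d2 = g * q" "coprime p q"
    using gcd_coprime_exists[of d1 d2] g0 unfolding g_def by (metis less_irrefl mult.commute)
  have p0: "0 < p" and q0: "0 < q" using pos pq g0 by (auto simp: zero_less_mult_iff)
  have c0: "0 < c" and cmin: "\<And>x y z. 0 < x \<Longrightarrow> 0 \<le> y \<Longrightarrow> 0 \<le> z \<Longrightarrow> x * d1 = y * d2 + z * d3 \<Longrightarrow> c \<le> x"
    using c unfolding least_relation_def by blast+
  have "c * p = k * q" using eq pq g0 by simp
  then have "q dvd c"
    using pq(3) by (metis coprime_commute coprime_dvd_mult_left_iff dvd_triv_right)
  then have qc: "q \<le> c" using c0 by (simp add: zdvd_imp_le)
  obtain x where x: "0 \<le> x" "x < q" "q dvd d3 - p * x"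
    using coprime_solve_mod pq(3) q0 by metis
  then obtain y where y: "d3 - p * x = q * y" by blast
  have "0 \<le> y"
  proof (rule ccontr)
    assume "\<not> 0 \<le> y"
    then have "q * y < 0" using q0 by (simp add: mult_pos_neg)
    with y pos have "0 < p * x" by linarith
    then have "0 < x" using p0 by (simp add: zero_less_mult_iff)
    have "p * x = d3 + q * (- y)" using y by simp
    then have "g * (p * x) = g * (d3 + q * (- y))" by simp
    then have "x * d1 = (- y) * d2 + g * d3"
      unfolding pq by (simp add: algebra_simps)
    then have "c \<le> x"
      using cmin[of x "- y" g] \<open>0 < x\<close> \<open>\<not> 0 \<le> y\<close> g0 by linarith
    with qc x show False by simp
  qed
  moreover have "d3 = x * p + y * q" using y by (simp add: algebra_simps)
  ultimately show ?thesis
    unfolding glued_def using g0 pq x(1) by blast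
qed

text \<open>If \<open>c \<le> x\<close>, then \<open>c * d2\<close> could be traded for
  \<open>r * d1 + s * d3\<close>. Here \<open>r \<noteq> 0\<close>, since otherwise the relation is
  degenerate and \<open>glued d2 d3 d1\<close> follows; a copy of \<open>d1\<close> gained this way
  pays for the subtracted one.\<close>

lemma apery_exponent_bound:
  assumes pos: "0 < d1" "0 < d2" "0 < d3"
    and c: "least_relation c d2 d1 d3" and ng: "\<not> glued d2 d3 d1"
    and nonmem: "x * d2 + y * d3 - d1 \<notin> semigroup3 d1 d2 d3" and y: "0 \<le> y"
  shows "x < c"
proof (rule ccontr)
  assume "\<not> x < c"
  obtain r s where rs: "0 \<le> r" "0 \<le> s" "c * d2 = r * d1 + s * d3"
    using c unfolding least_relation_def by blast
  have "r \<noteq> 0"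
    using glued_if_degenerate_relation[of d2 d3 d1 c s] pos c ng rs least_relation_commute by auto
  have "x * d2 + y * d3 - d1 = (r - 1) * d1 + (x - c) * d2 + (y + s) * d3"
    using rs(3) by (simp add: algebra_simps)
  with nonmem show False
    using semigroup3I[of "r - 1" "x - c" "y + s"] \<open>r \<noteq> 0\<close> \<open>\<not> x < c\<close> rs y by auto
qed

text \<open>Minimality of \<open>c\<close> makes \<open>(c - 1) * d2 - d1\<close> a gap, so by
  symmetry its reflection \<open>F - s\<close> is representable. That representation contains no
  \<open>d1\<close>, as \<open>F\<close> is a gap, and no \<open>d2\<close>, by the exponent
  bound.\<close>

lemma apery_maximum_edge:
  assumes pos: "0 < d1" "0 < d2" "0 < d3"
    and sym: "\<And>s. s \<in> semigroup3 d1 d2 d3 \<longleftrightarrow> F - s \<notin> semigroup3 d1 d2 d3"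
    and c: "least_relation c d2 d1 d3" and ng: "\<not> glued d2 d3 d1"
  obtains y where "0 \<le> y" "F + d1 = (c - 1) * d2 + y * d3"
proof -
  let ?S = "semigroup3 d1 d2 d3"
  have cmin: "\<And>x y z. 0 < x \<Longrightarrow> 0 \<le> y \<Longrightarrow> 0 \<le> z \<Longrightarrow> x * d2 = y * d1 + z * d3 \<Longrightarrow> c \<le> x"
    using c unfolding least_relation_def by blast
  have "0 \<in> ?S" by (rule semigroup3I[of 0 0 0]) auto
  then have F: "F \<notin> ?S" using sym[of 0] by simp
  have "(c - 1) * d2 - d1 \<notin> ?S"
  proof
    assume "(c - 1) * d2 - d1 \<in> ?S"
    then obtain x y z where xyz: "0 \<le> x" "0 \<le> y" "0 \<le> z" "(c - 1) * d2 - d1 = x * d1 + y * d2 + z * d3"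
      by (rule semigroup3E)
    have eq: "(c - 1 - y) * d2 = (x + 1) * d1 + z * d3"
      using xyz(4) by (simp add: algebra_simps)
    have "0 < (x + 1) * d1 + z * d3" using xyz pos by (simp add: add_pos_nonneg)
    then have "0 < c - 1 - y" using pos eq by (metis zero_less_mult_pos2)
    from cmin[OF this _ _ eq] xyz show False by auto
  qed
  then have "F - ((c - 1) * d2 - d1) \<in> ?S" using sym by blast
  then obtain x y z where xyz: "0 \<le> x" "0 \<le> y" "0 \<le> z"
    "F - ((c - 1) * d2 - d1) = x * d1 + y * d2 + z * d3"
    by (rule semigroup3E)
  have c0: "0 < c" using c unfolding least_relation_def by blast
  have x0: "x = 0"
  proof (rule ccontr)
    assume "x \<noteq> 0"
    have "F = (x - 1) * d1 + (c - 1 + y) * d2 + z * d3"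
      using xyz(4) by (simp add: algebra_simps)
    with F show False
      using semigroup3I[of "x - 1" "c - 1 + y" z F d1 d2 d3] xyz c0 \<open>x \<noteq> 0\<close> by simp
  qed
  have eq: "F = (c - 1 + y) * d2 + z * d3 - d1"
    using xyz(4) x0 by (simp add: algebra_simps)
  then have "c - 1 + y < c"
    using apery_exponent_bound[OF pos c ng] F xyz by metis
  then have "y = 0" using xyz by simp
  with eq xyz that[of z] show ?thesis by simp
qed

text \<open>The edge formulas for \<open>d2\<close> and for \<open>d3\<close> write
  \<open>F + d1\<close> in two ways. If the coefficients of \<open>d2\<close> differed, subtracting
  would give a positive multiple of \<open>d2\<close> below \<open>c2 * d2\<close> that is a
  multiple of \<open>d3\<close>, against the minimality of \<open>c2\<close>.\<close>

lemma apery_maximum_corner: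
  assumes pos: "0 < d1" "0 < d2" "0 < d3"
    and sym: "\<And>s. s \<in> semigroup3 d1 d2 d3 \<longleftrightarrow> F - s \<notin> semigroup3 d1 d2 d3"
    and c2: "least_relation c2 d2 d1 d3" and c3: "least_relation c3 d3 d1 d2"
    and ng: "\<not> glued d2 d3 d1"
  shows "F + d1 = (c2 - 1) * d2 + (c3 - 1) * d3"
proof -
  have "\<not> glued d3 d2 d1" using ng glued_commute by blast
  obtain y where y: "0 \<le> y" "F + d1 = (c2 - 1) * d2 + y * d3"
    using apery_maximum_edge[OF pos sym c2 ng] by blast
  obtain x where x: "0 \<le> x" "F + d1 = (c3 - 1) * d3 + x * d2"
    using apery_maximum_edge[of d1 d3 d2 F c3] pos sym c3 \<open>\<not> glued d3 d2 d1\<close>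
    by (metis semigroup3_swap23)
  have "0 \<in> semigroup3 d1 d2 d3" by (rule semigroup3I[of 0 0 0]) auto
  then have F: "F \<notin> semigroup3 d1 d2 d3" using sym[of 0] by simp
  have "F = x * d2 + (c3 - 1) * d3 - d1" using x by simp
  moreover have c30: "0 \<le> c3 - 1" using c3 unfolding least_relation_def by simp
  ultimately have "x < c2"
    using apery_exponent_bound[OF pos c2 ng] F by metis
  have eq: "(c2 - 1 - x) * d2 = 0 * d1 + (c3 - 1 - y) * d3"
    using x y by (simp add: algebra_simps)
  have "\<not> 0 < c2 - 1 - x"
  proof
    assume *: "0 < c2 - 1 - x"
    then have "0 < (c2 - 1 - x) * d2" using pos by simp
    with eq have "0 < (c3 - 1 - y) * d3" by linarith
    then have "0 < c3 - 1 - y" using pos by (metis zero_less_mult_pos2)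
    with * eq c2 have "c2 \<le> c2 - 1 - x"
      unfolding least_relation_def by (metis less_imp_le order_refl)
    with x show False by simp
  qed
  with \<open>x < c2\<close> have "x = c2 - 1" by simp
  with x show ?thesis by simp
qed

lemma glued_if_symmetric:
  assumes pos: "0 < d1" "0 < d2" "0 < d3"
    and S: "symmetric_semigroup (semigroup3 d1 d2 d3)"
  shows "glued d1 d2 d3 \<or> glued d1 d3 d2 \<or> glued d2 d3 d1"
proof (rule ccontr)
  assume "\<not> ?thesis"
  then have ng: "\<not> glued d1 d2 d3" "\<not> glued d1 d3 d2" "\<not> glued d2 d3 d1" by auto
  define F where "F = frobenius_number (semigroup3 d1 d2 d3)"
  have sym: "s \<in> semigroup3 d1 d2 d3 \<longleftrightarrow> F - s \<notin> semigroup3 d1 d2 d3" for s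
    using S unfolding symmetric_semigroup_def F_def by blast
  obtain c1 where c1: "least_relation c1 d1 d2 d3" using least_relation_exists pos by blast
  obtain c2 where c2: "least_relation c2 d2 d1 d3" using least_relation_exists pos by blast
  obtain c3 where c3: "least_relation c3 d3 d1 d2" using least_relation_exists pos by blast
  have "F + d1 = (c2 - 1) * d2 + (c3 - 1) * d3"
    using apery_maximum_corner[OF pos sym c2 c3] ng by blast
  moreover have "F + d2 = (c1 - 1) * d1 + (c3 - 1) * d3"
    using apery_maximum_corner[of d2 d1 d3 F c1 c3] pos sym c1 c3 ng
    by (metis semigroup3_swap12 least_relation_commute)
  ultimately have "c1 * d1 = c2 * d2" by (simp add: algebra_simps)
  with glued_if_degenerate_relation[OF pos c1] ng show False by blast
qed

section \<open>Sufficiency: a gluing forces symmetry\<close>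

lemma symmetric_semigroupI:
  assumes sym: "\<And>s. s \<in> S \<longleftrightarrow> F - s \<notin> S" and nonneg: "\<And>s. s \<in> S \<Longrightarrow> 0 \<le> s" and "0 \<in> S"
  shows "symmetric_semigroup S"
proof -
  have "frobenius_number S = F"
    unfolding frobenius_number_def
  proof (rule Greatest_equality)
    show "F \<notin> S" using sym[of 0] \<open>0 \<in> S\<close> by simp
    \<comment> \<open>A gap \<open>s\<close> reflects to the element \<open>F - s\<close>, which is
      nonnegative; so \<open>F\<close> need not be computed separately.\<close>
    show "s \<le> F" if "s \<notin> S" for s using sym[of s] nonneg[of "F - s"] that by simp
  qed
  then show ?thesis unfolding symmetric_semigroup_def using sym by blast
qed

text \<open>The middle generator \<open>d\<close> plays the part of \<open>d3\<close> in the
  overview.\<close>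

lemma symmetric_if_glued:
  fixes g p q d u v :: int
  assumes g: "0 < g" and p: "0 < p" and q: "0 < q" and pq: "coprime p q" and gd: "coprime g d"
    and uv: "0 \<le> u" "0 \<le> v" and d: "d = u * p + v * q"
  shows "symmetric_semigroup (semigroup3 (g * p) d (g * q))"
proof -
  let ?S = "semigroup3 (g * p) d (g * q)"
  define e where "e x y z = g * p * x + g * q * y + d * z" for x y z
  have coords: "\<exists>x y z. 0 \<le> y \<and> y < p \<and> 0 \<le> z \<and> z < g \<and> s = e x y z" for s
  proof -
    obtain z where z: "0 \<le> z" "z < g" "g dvd s - d * z"
      using coprime_solve_mod gd g by (metis coprime_commute)
    then obtain t where t: "s - d * z = g * t" by blast
    obtain y where y: "0 \<le> y" "y < p" "p dvd t - q * y"
      using coprime_solve_mod pq p by (metis coprime_commute)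
    then obtain x where x: "t - q * y = p * x" by blast
    have "s = g * (p * x + q * y) + d * z" using t x by (simp add: algebra_simps)
    then have "s = e x y z" unfolding e_def by (simp add: algebra_simps)
    with y z show ?thesis by blast
  qed
  have uniq: "x = x'"
    if eq: "e x y z = e x' y' z'" and "0 \<le> y" "y < p" "0 \<le> z" "z < g"
      "0 \<le> y'" "y' < p" "0 \<le> z'" "z' < g" for x y z x' y' z'
  proof -
    have eq_if_dvd: "i = j" if "0 \<le> i" "i < m" "0 \<le> j" "j < m" "m dvd i - j" for i j m :: int
      using that by (metis mod_eq_dvd_iff mod_pos_pos_trivial)
    have "d * (z - z') = g * (p * (x' - x) + q * (y' - y))"
      using eq unfolding e_def by (simp add: algebra_simps)
    then have "g dvd z - z'" using gd by (metis coprime_dvd_mult_right_iff dvd_triv_left)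
    then have "z = z'" using eq_if_dvd that by blast
    then have "g * (q * (y - y')) = g * (p * (x' - x))"
      using eq unfolding e_def by (simp add: algebra_simps)
    then have eq': "q * (y - y') = p * (x' - x)" using g by simp
    then have "p dvd y - y'" using pq by (metis coprime_dvd_mult_right_iff dvd_triv_left)
    then have "y = y'" using eq_if_dvd that by blast
    with eq' p show ?thesis by simp
  qed
  have mem: "e x y z \<in> ?S \<longleftrightarrow> 0 \<le> x" if yz: "0 \<le> y" "y < p" "0 \<le> z" "z < g" for x y z
  proof
    assume "0 \<le> x"
    then show "e x y z \<in> ?S"
      using yz by (intro semigroup3I[of x z y]) (auto simp: e_def algebra_simps)
  next
    assume "e x y z \<in> ?S"
    then obtain a b c where abc: "0 \<le> a" "0 \<le> b" "0 \<le> c" "e x y z = a * (g * p) + b * d + c * (g * q)"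
      by (rule semigroup3E)
    \<comment> \<open>Normalisation: every \<open>g\<close> copies of \<open>d\<close> become
      \<open>u\<close> copies of \<open>g * p\<close> and \<open>v\<close> copies of
      \<open>g * q\<close>; then every \<open>p\<close> copies of \<open>g * q\<close> become
      \<open>q\<close> copies of \<open>g * p\<close>. Neither move lowers the coefficient of
      \<open>g * p\<close>.\<close>
    define k where "k = b div g"
    define c' where "c' = c + k * v"
    have k: "0 \<le> k" using abc g by (simp add: k_def pos_imp_zdiv_nonneg_iff)
    then have c': "0 \<le> c'" using abc uv by (simp add: c'_def)
    define j r where "j = c' div p" and "r = c' mod p"
    define x' where "x' = a + k * u + q * j"
    have b: "b = g * k + b mod g" unfolding k_def by simp
    have c'_eq: "c' = p * j + r" by (simp add: j_def r_def)
    have "a * (g * p) + b * d + c * (g * q) = a * (g * p) + (g * k + b mod g) * d + c * (g * q)"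
      using b by simp
    also have "\<dots> = g * p * (a + k * u) + g * q * c' + d * (b mod g)"
      unfolding c'_def d by (simp add: algebra_simps)
    also have "\<dots> = g * p * (a + k * u) + g * q * (p * j + r) + d * (b mod g)"
      using c'_eq by simp
    also have "\<dots> = e x' r (b mod g)"
      unfolding e_def x'_def by (simp add: algebra_simps)
    finally have "e x y z = e x' r (b mod g)" using abc(4) by simp
    then have "x = x'" using uniq yz g p by (simp add: r_def)
    also have "0 \<le> x'"
      using abc uv k c' p q by (simp add: x'_def j_def pos_imp_zdiv_nonneg_iff)
    finally show "0 \<le> x" .
  qed
  define F where "F = e (- 1) (p - 1) (g - 1)"
  show ?thesis
  proof (rule symmetric_semigroupI)
    show "s \<in> ?S \<longleftrightarrow> F - s \<notin> ?S" for s
    proof -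
      obtain x y z where xyz: "0 \<le> y" "y < p" "0 \<le> z" "z < g" "s = e x y z"
        using coords by blast
      have "F - s = e (- 1 - x) (p - 1 - y) (g - 1 - z)"
        unfolding F_def xyz e_def by (simp add: algebra_simps)
      then show ?thesis
        using mem[of y z x] mem[of "p - 1 - y" "g - 1 - z" "- 1 - x"] xyz by auto
    qed
    show "0 \<le> s" if "s \<in> ?S" for s
      using that g p q uv unfolding d by (auto elim!: semigroup3E)
    show "0 \<in> ?S" by (rule semigroup3I[of 0 0 0]) auto
  qed
qed

section \<open>Gluings among three consecutive squares\<close>

lemma glued_coprime:
  assumes "glued d1 d2 d3" "coprime d1 d2"
  obtains u v where "0 \<le> u" "0 \<le> v" "d3 = u * d1 + v * d2"
proof -
  obtain g p q u v where *: "0 < g" "d1 = g * p" "d2 = g * q" "0 \<le> u" "0 \<le> v" "d3 = u * p + v * q"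
    using assms(1) unfolding glued_def by blast
  have "is_unit g" using coprime_common_divisor[OF assms(2), of g] * by simp
  then have "g = 1" using * by simp
  with * that show ?thesis by simp
qed

text \<open>A sum of two or more generators is at least \<open>2 * a\<close>, and the hypotheses on
  \<open>d\<close> exclude sums of at most one.\<close>

lemma not_combination_below_double:
  fixes a b d u v :: int
  assumes "0 < a" "a \<le> b" "d < 2 * a" "d \<noteq> 0" "d \<noteq> a" "d \<noteq> b" "0 \<le> u" "0 \<le> v"
  shows "d \<noteq> u * a + v * b"
proof
  assume d: "d = u * a + v * b"
  have "v * a \<le> v * b" using assms by (simp add: mult_left_mono)
  then have "(u + v) * a \<le> d" unfolding d by (simp add: algebra_simps)
  also have "\<dots> < 2 * a" by fact
  finally have "u + v < 2" using assms by simp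
  then have "(u = 0 \<and> v = 0) \<or> (u = 1 \<and> v = 0) \<or> (u = 0 \<and> v = 1)" using assms by linarith
  with d assms show False by auto
qed

text \<open>This handles odd \<open>n = 2 * m + 1\<close>, where the outer squares are
  \<open>4 * m^2\<close> and \<open>4 * (m + 1)^2\<close>. Modulo \<open>m\<close> an equality would
  give \<open>v \<equiv> 1\<close>; but \<open>v = 1\<close> forces \<open>m dvd 2\<close>, and
  \<open>v \<ge> m + 1\<close> makes the right side too large.\<close>

lemma odd_square_not_combination:
  fixes m u v :: int
  assumes m: "3 \<le> m" and uv: "0 \<le> u" "0 \<le> v"
  shows "(2 * m + 1)^2 \<noteq> u * m^2 + v * (m + 1)^2"
proof
  assume eq: "(2 * m + 1)^2 = u * m^2 + v * (m + 1)^2"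
  have "v - 1 = m * (4 * m + 4 - u * m - v * m - 2 * v)"
    using eq by (simp add: power2_eq_square algebra_simps)
  then obtain k where k: "v = 1 + m * k" by (metis add_diff_cancel_left' diff_add_cancel add.commute)
  have "0 \<le> k"
  proof (rule ccontr)
    assume "\<not> 0 \<le> k"
    then have "m * k \<le> m * (- 1)" using m by (intro mult_left_mono) auto
    with k uv m show False by simp
  qed
  show False
  proof (cases "k = 0")
    case True
    with eq k have "m * (m * (u - 3)) = m * 2"
      by (simp add: power2_eq_square algebra_simps)
    then have "m * (u - 3) = 2" using m by simp
    then have "m dvd 2" by (metis dvd_triv_left)
    with m show False using zdvd_imp_le[of m 2] by simp
  next
    case False
    with \<open>0 \<le> k\<close> have "m * 1 \<le> m * k" using m by (intro mult_left_mono) auto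
    with k have "m + 1 \<le> v" by simp
    then have "(m + 1) * (m + 1)^2 \<le> v * (m + 1)^2" by (rule mult_right_mono) simp
    also have "\<dots> \<le> (2 * m + 1)^2" using eq uv by simp
    finally have "m * (m * m) \<le> m * (m + 1)" by (simp add: power2_eq_square algebra_simps)
    then have "m * m \<le> m + 1" using m by simp
    moreover have "3 * m \<le> m * m" using m by simp
    ultimately show False using m by simp
  qed
qed

lemma coprime_consecutive_squares: "coprime (n^2) ((n + 1)^2)" for n :: int
  by (simp add: coprime_add_one_right)

theorem proposition1:
  fixes n :: int
  assumes "n \<ge> 3"
  shows "symmetric_semigroup (semigroup3 ((n - 1)^2) (n^2) ((n + 1)^2)) \<longleftrightarrow> n \<in> {3, 4, 5}"
proof
  assume S: "symmetric_semigroup (semigroup3 ((n - 1)^2) (n^2) ((n + 1)^2))"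
  show "n \<in> {3, 4, 5}"
  proof (rule ccontr)
    assume "n \<notin> {3, 4, 5}"
    with assms have n: "6 \<le> n" by auto
    have pos: "0 < (n - 1)^2" "0 < n^2" "0 < (n + 1)^2" using n by auto
    \<comment> \<open>The bound \<open>(n + 1)^2 < 2 * (n - 1)^2\<close> amounts to
      \<open>n * n - 6 * n + 1 > 0\<close>, which fails at \<open>n = 5\<close>.\<close>
    have "6 * n \<le> n * n" using n by simp
    moreover have "(n - 1)^2 = n * n - 2 * n + 1" "n^2 = n * n" "(n + 1)^2 = n * n + 2 * n + 1"
      by (simp_all add: power2_eq_square algebra_simps)
    ultimately have lt: "(n - 1)^2 < n^2" "n^2 < (n + 1)^2" "(n + 1)^2 < 2 * (n - 1)^2"
      using n by linarith+
    from glued_if_symmetric[OF pos S] consider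
      "glued ((n - 1)^2) (n^2) ((n + 1)^2)" | "glued ((n - 1)^2) ((n + 1)^2) (n^2)"
      | "glued (n^2) ((n + 1)^2) ((n - 1)^2)" by blast
    then show False
    proof cases
      case 1
      then obtain u v where "0 \<le> u" "0 \<le> v" "(n + 1)^2 = u * (n - 1)^2 + v * n^2"
        using glued_coprime[OF 1] coprime_consecutive_squares[of "n - 1"] by auto
      then show False
        using not_combination_below_double[of "(n - 1)^2" "n^2" "(n + 1)^2" u v] lt pos by auto
    next
      case 3
      then obtain u v where "0 \<le> u" "0 \<le> v" "(n - 1)^2 = u * n^2 + v * (n + 1)^2"
        using glued_coprime[OF 3] coprime_consecutive_squares[of n] by auto
      then show False
        using not_combination_below_double[of "n^2" "(n + 1)^2" "(n - 1)^2" u v] lt pos by auto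
    next
      case 2
      show False
      proof (cases "even n")
        case True
        have "coprime (n - 1) (n + 1)"
        proof (rule coprimeI)
          fix c assume c: "c dvd n - 1" "c dvd n + 1"
          then have "c dvd (n + 1) - (n - 1)" by (rule dvd_diff[rotated])
          then have "c dvd 2" by simp
          \<comment> \<open>Since \<open>c\<close> divides 2, it divides the even \<open>n\<close>;
            with \<open>c dvd n + 1\<close> it divides 1.\<close>
          have "c dvd n * 1" using c True \<open>c dvd 2\<close> by (metis dvd_trans mult.right_neutral)
          with c show "is_unit c" by (metis dvd_add_right_iff mult.right_neutral)
        qed
        then have "coprime ((n - 1)^2) ((n + 1)^2)" by simp
        then obtain u v where "0 \<le> u" "0 \<le> v" "n^2 = u * (n - 1)^2 + v * (n + 1)^2"
          using glued_coprime[OF 2] by blast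
        then show False
          using not_combination_below_double[of "(n - 1)^2" "(n + 1)^2" "n^2" u v] lt pos by auto
      next
        case False
        then obtain m where m: "n = 2 * m + 1" by (rule oddE)
        obtain g p q u v where *: "0 < g" "(n - 1)^2 = g * p" "(n + 1)^2 = g * q" "coprime p q"
          "0 \<le> u" "0 \<le> v" "n^2 = u * p + v * q"
          using 2 unfolding glued_def by blast
        have sq: "(n - 1)^2 = 4 * m^2" "(n + 1)^2 = 4 * (m + 1)^2"
          unfolding m by (simp_all add: power2_eq_square algebra_simps)
        \<comment> \<open>Coprimality of \<open>p\<close> and \<open>q\<close> identifies the
          existential \<open>g\<close> as the gcd of the outer squares.\<close>
        have "g = gcd (g * p) (g * q)"
          using * by (simp add: gcd_mult_distrib_int[symmetric] coprime_iff_gcd_eq_1)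
        also have "\<dots> = gcd (4 * m^2) (4 * (m + 1)^2)" using * sq by simp
        also have "\<dots> = 4"
          using coprime_consecutive_squares[of m]
          by (simp add: gcd_mult_distrib_int[symmetric] coprime_iff_gcd_eq_1)
        finally have "p = m^2" "q = (m + 1)^2" using * sq by auto
        with * m n odd_square_not_combination[of m u v] show False by simp
      qed
    qed
  qed
next
  assume "n \<in> {3, 4, 5}"
  then consider "n = 3" | "n = 4" | "n = 5" by auto
  then show "symmetric_semigroup (semigroup3 ((n - 1)^2) (n^2) ((n + 1)^2))"
  proof cases
    case 1
    \<comment> \<open>Here \<open>16 = 4 * 4 + 0 * 9\<close>.\<close>
    have "symmetric_semigroup (semigroup3 (1 * 4) 16 (1 * 9))"
      by (rule symmetric_if_glued[of _ _ _ _ 4 0]) (simp_all add: coprime_iff_gcd_eq_1 gcd_non_0_int)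
    with 1 show ?thesis by (simp add: semigroup3_swap23)
  next
    case 2
    \<comment> \<open>Here \<open>25 = 1 * 9 + 1 * 16\<close>.\<close>
    have "symmetric_semigroup (semigroup3 (1 * 9) 25 (1 * 16))"
      by (rule symmetric_if_glued[of _ _ _ _ 1 1]) (simp_all add: coprime_iff_gcd_eq_1 gcd_non_0_int)
    with 2 show ?thesis by (simp add: semigroup3_swap23)
  next
    case 3
    \<comment> \<open>The outer squares 16 and 36 have gcd 4, and
      \<open>25 = 4 * 4 + 1 * 9\<close>.\<close>
    have "symmetric_semigroup (semigroup3 (4 * 4) 25 (4 * 9))"
      by (rule symmetric_if_glued[of _ _ _ _ 4 1]) (simp_all add: coprime_iff_gcd_eq_1 gcd_non_0_int)
    with 3 show ?thesis by simp
  qed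
qed

end
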